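(* Let $S\in\mathrm{Sp}(d,\mathbb{C})$ be such that $\widetilde S=S$. The following statements are equivalent. (i) $S\in\mathrm{Sp}_+(d,\mathbb{C})$. (ii) Writing $S=\begin{pmatrix} A & iB \\ i C & D \end{pmatrix}$ with $A,B,C,D\in\mathbb{R}^{d\times d}$ and $\begin{pmatrix} A & -B \\ C & D \end{pmatrix}\in\mathrm{Sp}(d,\mathbb{R})$, one has $$A\in\mathrm{GL}(d,\mathbb{R}),\qquad A^\top C\ge0,\qquad AB^\top\le0.$$ (iii) Writing $S=\begin{pmatrix} A & B \\ C & D \end{pmatrix}$ with $A,B,C,D\in\mathbb{C}^{d\times d}$, one has $\Re(C)=\Re(B)=O_d$ and $$A\in\mathrm{GL}(d,\mathbb{R}),\qquad\Im(A^\top C)\ge0,\qquad\Im(AB^\top)\le0.$$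
   Context: $J=\begin{pmatrix} O_d & I_d \\ -I_d & O_d \end{pmatrix}$. For $\mathbb{F}=\mathbb{R},\mathbb{C}$, $\mathrm{Sp}(d,\mathbb{F})=\{S\in\mathbb{F}^{2d\times2d}:S^\top JS=J\}$. $\mathrm{Sp}_+(d,\mathbb{C})$ is the semigroup of $S\in\mathrm{Sp}(d,\mathbb{C})$ with $i^{-1}(\sigma(Sz,\overline{Sz})-\sigma(z,\overline z))\ge0$ for all $z\in\mathbb{C}^{2d}$, where $\sigma(z,w)=Jz\cdot w$ (bilinear dot product). For $S=\begin{pmatrix} A & B \\ C & D \end{pmatrix}\in\mathrm{Sp}(d,\mathbb{C})$ with $d\times d$ blocks, $\widetilde S=\begin{pmatrix} \overline A & -\overline B \\ -\overline C & \overline D \end{pmatrix}$; every $S\in\mathrm{Sp}(d,\mathbb{C})$ with $\widetilde S=S$ has a block decomposition of the form in (ii), with $\begin{pmatrix} A & -B \\ C & D \end{pmatrix}\in\mathrm{Sp}(d,\mathbb{R})$. For real symmetric matrices, $\ge0$ (resp. $\le0$) means positive (resp. negative) semi-definite. *)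

theory Defs
  imports "HOL-Analysis.Analysis"
begin

(* The index type 'd has d elements, and ('d + 'd) indexes 2d coordinates:
   Inl for the first d of them, Inr for the last d. *)

definition block_mat ::
  "'a^'d^'d \<Rightarrow> 'a^'d^'d \<Rightarrow> 'a^'d^'d \<Rightarrow> 'a^'d^'d \<Rightarrow> 'a^('d::finite + 'd)^('d + 'd)" where
  "block_mat A B C D =
     (\<chi> i j. case i of
        Inl k \<Rightarrow> (case j of Inl l \<Rightarrow> A $ k $ l | Inr l \<Rightarrow> B $ k $ l)
      | Inr k \<Rightarrow> (case j of Inl l \<Rightarrow> C $ k $ l | Inr l \<Rightarrow> D $ k $ l))"

definition block11 :: "'a^('d::finite + 'd)^('d + 'd) \<Rightarrow> 'a^'d^'d" where
  "block11 S = (\<chi> k l. S $ Inl k $ Inl l)"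

definition block12 :: "'a^('d::finite + 'd)^('d + 'd) \<Rightarrow> 'a^'d^'d" where
  "block12 S = (\<chi> k l. S $ Inl k $ Inr l)"

definition block21 :: "'a^('d::finite + 'd)^('d + 'd) \<Rightarrow> 'a^'d^'d" where
  "block21 S = (\<chi> k l. S $ Inr k $ Inl l)"

definition block22 :: "'a^('d::finite + 'd)^('d + 'd) \<Rightarrow> 'a^'d^'d" where
  "block22 S = (\<chi> k l. S $ Inr k $ Inr l)"

definition J_mat :: "'a::comm_ring_1^('d::finite + 'd)^('d + 'd)" where
  "J_mat = block_mat 0 (mat 1) (- mat 1) 0"

definition Sp :: "('a::field^('d::finite + 'd)^('d + 'd)) set" where
  "Sp = {S. transpose S ** J_mat ** S = J_mat}"

(* The dot product here is bilinear, not sesquilinear, also over the complex numbers. *)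
definition sigma :: "'a::field^('d::finite + 'd) \<Rightarrow> 'a^('d + 'd) \<Rightarrow> 'a" where
  "sigma z w = scalar_product (J_mat *v z) w"

definition cnj_vec :: "complex^'n \<Rightarrow> complex^'n" where
  "cnj_vec z = (\<chi> i. cnj (z $ i))"

definition Sp_plus :: "(complex^('d::finite + 'd)^('d + 'd)) set" where
  "Sp_plus = {S \<in> Sp. \<forall>z.
     inverse \<i> * (sigma (S *v z) (cnj_vec (S *v z)) - sigma z (cnj_vec z)) \<in> \<real>\<^sub>\<ge>\<^sub>0}"

definition tilde_mat ::
  "complex^('d::finite + 'd)^('d + 'd) \<Rightarrow> complex^('d + 'd)^('d + 'd)" where
  "tilde_mat S = block_mat
     (map_matrix cnj (block11 S)) (- map_matrix cnj (block12 S))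
     (- map_matrix cnj (block21 S)) (map_matrix cnj (block22 S))"

definition pos_semidef :: "real^'n^'n \<Rightarrow> bool" where
  "pos_semidef M \<longleftrightarrow> transpose M = M \<and> (\<forall>x. 0 \<le> x \<bullet> (M *v x))"

definition neg_semidef :: "real^'n^'n \<Rightarrow> bool" where
  "neg_semidef M \<longleftrightarrow> transpose M = M \<and> (\<forall>x. x \<bullet> (M *v x) \<le> 0)"

lemma block_mat_collapse:
  "block_mat (block11 S) (block12 S) (block21 S) (block22 S) = S"
  by (simp add: vec_eq_iff block_mat_def block11_def block12_def block21_def block22_def
      split: sum.split)

lemma blocks_block_mat [simp]:
  "block11 (block_mat A B C D) = A" "block12 (block_mat A B C D) = B"
  "block21 (block_mat A B C D) = C" "block22 (block_mat A B C D) = D"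
  by (simp_all add: vec_eq_iff block_mat_def block11_def block12_def block21_def block22_def)

lemma block_mat_eq_iff:
  "block_mat A B C D = block_mat A' B' C' D' \<longleftrightarrow> A = A' \<and> B = B' \<and> C = C' \<and> D = D'"
  by (metis blocks_block_mat)

lemma sum_UNIV_Plus:
  "(\<Sum>k\<in>(UNIV :: ('d::finite + 'd) set). f k) = (\<Sum>k\<in>UNIV. f (Inl k)) + (\<Sum>k\<in>UNIV. f (Inr k))"
  unfolding UNIV_Plus_UNIV[symmetric] by (subst sum.Plus) auto

lemma block_mat_mult:
  "block_mat A B C D ** block_mat A' B' C' D' =
   block_mat (A ** A' + B ** C') (A ** B' + B ** D') (C ** A' + D ** C') (C ** B' + D ** D')"
  by (simp add: vec_eq_iff block_mat_def matrix_matrix_mult_def sum_UNIV_Plus split: sum.split)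

lemma transpose_block_mat:
  "transpose (block_mat A B C D) =
   block_mat (transpose A) (transpose C) (transpose B) (transpose D)"
  by (simp add: vec_eq_iff block_mat_def transpose_def split: sum.split)

lemma Sp_block_mat_iff:
  "block_mat A B C D \<in> Sp \<longleftrightarrow>
     transpose A ** C = transpose C ** A \<and>
     transpose A ** D - transpose C ** B = mat 1 \<and>
     transpose D ** A - transpose B ** C = mat 1 \<and>
     transpose B ** D = transpose D ** B"
proof -
  have neg: "X ** (- mat 1) = - X" "(- X) ** Y = - (X ** Y)" for X Y :: "'a^'b^'b"
    by (simp_all add: vec_eq_iff matrix_matrix_mult_def mat_def sum_negf if_distrib cong: if_cong)
  have z: "X ** 0 = 0" for X :: "'a^'b^'b"
    by (simp add: vec_eq_iff matrix_matrix_mult_def)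
  have eqs: "- X + Y = - Z \<longleftrightarrow> X - Y = Z" "- X + Y = 0 \<longleftrightarrow> Y = X" "- X + Y = Z \<longleftrightarrow> Y - X = Z"
    "Y - X = - Z \<longleftrightarrow> X - Y = Z"
    for X Y Z :: "'a^'b^'b"
    by (auto simp: algebra_simps add_eq_0_iff)
  show ?thesis
    by (auto simp: Sp_def J_mat_def transpose_block_mat block_mat_mult block_mat_eq_iff neg z eqs)
qed

(* By block_mat_eq_iff the decomposition below is unique. *)
lemma tilde_fixed_decomposition:
  fixes S :: "complex^('d::finite + 'd)^('d + 'd)"
  assumes "S \<in> Sp" and "tilde_mat S = S"
  shows "\<exists>A B C D :: real^'d^'d.
    S = block_mat (map_matrix complex_of_real A) (map_matrix (\<lambda>b. \<i> * complex_of_real b) B)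
          (map_matrix (\<lambda>c. \<i> * complex_of_real c) C) (map_matrix complex_of_real D) \<and>
    block_mat A (- B) C D \<in> Sp"
proof -
  define A where "A = map_matrix Re (block11 S)"
  define B where "B = map_matrix Im (block12 S)"
  define C where "C = map_matrix Im (block21 S)"
  define D where "D = map_matrix Re (block22 S)"
  let ?r = "map_matrix complex_of_real" and ?i = "map_matrix (\<lambda>b. \<i> * complex_of_real b)"
  have "map_matrix cnj (block11 S) = block11 S" "- map_matrix cnj (block12 S) = block12 S"
    "- map_matrix cnj (block21 S) = block21 S" "map_matrix cnj (block22 S) = block22 S"
    using assms(2) by (metis tilde_mat_def blocks_block_mat)+
  then have bl: "block11 S = ?r A" "block12 S = ?i B" "block21 S = ?i C" "block22 S = ?r D"
    unfolding A_def B_def C_def D_def by (auto simp: vec_eq_iff complex_eq_iff)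
  then have S: "S = block_mat (?r A) (?i B) (?i C) (?r D)"
    by (metis block_mat_collapse)
  have tr: "transpose (?r X) = ?r (transpose X)" "transpose (?i X) = ?i (transpose X)"
    for X :: "real^'d^'d"
    by (simp_all add: vec_eq_iff transpose_def)
  have mult: "?r X ** ?r Y = ?r (X ** Y)" "?r X ** ?i Y = ?i (X ** Y)"
    "?i X ** ?r Y = ?i (X ** Y)" "?i X ** ?i Y = - ?r (X ** Y)" for X Y :: "real^'d^'d"
    by (simp_all add: vec_eq_iff matrix_matrix_mult_def sum_distrib_left sum_negf
        mult.assoc mult.left_commute complex_eq_iff)
  have inj: "?r X = ?r Y \<longleftrightarrow> X = Y" "?i X = ?i Y \<longleftrightarrow> X = Y" for X Y :: "real^'d^'d"
    by (simp_all add: vec_eq_iff)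
  have one: "mat 1 = ?r (mat 1)" by (simp add: vec_eq_iff mat_def)
  have add: "?r X + ?r Y = ?r (X + Y)" for X Y :: "real^'d^'d"
    by (simp add: vec_eq_iff)
  have neg: "transpose (- X) = - transpose X" "X ** (- Y) = - (X ** Y)" "(- X) ** Y = - (X ** Y)"
    for X Y :: "real^'d^'d"
    by (simp_all add: vec_eq_iff transpose_def matrix_matrix_mult_def sum_negf)
  from assms(1) have "block_mat A (- B) C D \<in> Sp"
    unfolding S by (simp add: Sp_block_mat_iff tr mult inj one add neg)
  with S show ?thesis by blast
qed

end

theory Submission
  imports Defs
begin

text \<open>
  Call \<open>x \<bullet> y\<close> the pairing of a real phase-space point \<open>(x, y)\<close>. The theorem holds because,
  for \<open>S\<close> with blocks \<open>A, iB, iC, D\<close>, membership in the semigroup says exactly that the real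
  symplectic matrix \<open>T\<close> with blocks \<open>A, -B, C, D\<close> never decreases the pairing.

  Indeed, \<open>\<sigma>(z, cnj z) / i\<close> for \<open>z = (a + ib, c + id)\<close> is \<open>2 (a \<bullet> d - b \<bullet> c)\<close>, that is,
  twice the sum of the pairings of \<open>(a, d)\<close> and of \<open>(b, -c)\<close>. The factors \<open>i\<close> on the off-diagonal blocks
  make \<open>S\<close> act on these two real points separately, on each of them as \<open>T\<close>. The
  condition on all complex \<open>z\<close> thus decouples into one real condition (\<open>Sp_plus_iff_expands_pairing\<close>).

  The real condition is solved by completing the square. If \<open>A e = B y\<close>, then
  \<open>T\<close> increases the pairing of \<open>(x, y)\<close> by \<open>(x - e)\<^sup>T A\<^sup>T C (x - e) - e \<bullet> y\<close>
  (\<open>pairing_gain_complete_square\<close>). When \<open>A\<close> is invertible, such an \<open>e\<close> exists for every \<open>y\<close> and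
  \<open>x - e\<close> is arbitrary, so the gain is always nonnegative iff \<open>A\<^sup>T C\<close> is positive
  semidefinite and \<open>e \<bullet> y \<le> 0\<close> throughout; with \<open>y = A\<^sup>T w\<close>, the number \<open>e \<bullet> y\<close> is the value of
  \<open>A B\<^sup>T\<close> at \<open>w\<close>. Invertibility is forced: if \<open>A x = 0\<close>, then the pairing along the line
  \<open>(x, t x)\<close> changes by \<open>-2 t (x \<bullet> x) + O(t\<^sup>2)\<close>, which is negative for small \<open>t > 0\<close>
  unless \<open>x = 0\<close> (\<open>expands_pairing_imp_invertible\<close>).
\<close>

section \<open>Symplectic block matrices\<close>

abbreviation cmat :: "real^'n^'m \<Rightarrow> complex^'n^'m" where
  "cmat \<equiv> map_matrix complex_of_real"

abbreviation imat :: "real^'n^'m \<Rightarrow> complex^'n^'m" where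
  "imat \<equiv> map_matrix (\<lambda>b. \<i> * complex_of_real b)"

lemma inner_vector_matrix: "x \<bullet> (y v* M) = (M *v x) \<bullet> (y :: real^'n)"
  by (metis dot_lmul_matrix inner_commute)

lemma uminus_matrix_mult:
  fixes X Y :: "'a::ring_1^'n::finite^'n"
  shows "(- X) ** Y = - (X ** Y)" "X ** (- Y) = - (X ** Y)" "transpose (- X) = - transpose X"
  by (simp_all add: vec_eq_iff transpose_def matrix_matrix_mult_def sum_negf)

text \<open>The bilinear form of the relation \<open>A\<^sup>T D + C\<^sup>T B = I\<close>, one of the block relations of a
  symplectic matrix with upper right block \<open>-B\<close>.\<close>

lemma Sp_blocks_inner:
  fixes A B C D :: "real^'d::finite^'d"
  assumes "block_mat A (- B) C D \<in> Sp"
  shows "(A *v x) \<bullet> (D *v y) + (B *v y) \<bullet> (C *v x) = x \<bullet> y"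
proof -
  have "transpose A ** D + transpose C ** B = mat 1"
    using assms by (simp add: Sp_block_mat_iff uminus_matrix_mult)
  then have "x \<bullet> ((transpose A ** D + transpose C ** B) *v y) = x \<bullet> y"
    by simp
  then show ?thesis
    by (simp add: matrix_vector_mult_add_rdistrib inner_add_right inner_vector_matrix inner_commute
        flip: matrix_vector_mul_assoc)
qed

lemma J_mat_square: "J_mat ** J_mat = (- mat 1 :: 'a::comm_ring_1^('d::finite + 'd)^('d + 'd))"
proof -
  have "(- mat 1 :: 'a^('d + 'd)^('d + 'd)) = block_mat (- mat 1) 0 0 (- mat 1)"
    by (auto simp: vec_eq_iff block_mat_def mat_def split: sum.split)
  moreover have z: "X ** 0 = 0" "0 ** X = 0" for X :: "'a^'d^'d"
    by (simp_all add: vec_eq_iff matrix_matrix_mult_def)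
  ultimately show ?thesis
    by (simp add: J_mat_def block_mat_mult uminus_matrix_mult z)
qed

text \<open>Since \<open>J\<^sup>2 = -I\<close>, the relation \<open>S\<^sup>T J S = J\<close> says that \<open>-J S\<^sup>T J\<close> is a left inverse of \<open>S\<close>.
  It is then also a right inverse, which is the same relation for \<open>S\<^sup>T\<close>. The lemma supplies
  the symmetry of \<open>A B\<^sup>T\<close>.\<close>

lemma transpose_in_Sp:
  assumes "S \<in> Sp"
  shows "transpose S \<in> Sp"
proof -
  have "- (J_mat ** transpose S ** J_mat) ** S = - (J_mat ** (transpose S ** J_mat ** S))"
    by (simp add: uminus_matrix_mult matrix_mul_assoc)
  also have "\<dots> = mat 1"
    using assms by (simp add: Sp_def J_mat_square)
  finally have "S ** - (J_mat ** transpose S ** J_mat) = mat 1"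
    by (simp add: matrix_left_right_inverse)
  then have "S ** - (J_mat ** transpose S ** J_mat) ** J_mat = J_mat"
    by simp
  moreover have "S ** - (J_mat ** transpose S ** J_mat) ** J_mat
      = - (S ** J_mat ** transpose S ** (J_mat ** J_mat))"
    by (simp add: uminus_matrix_mult matrix_mul_assoc)
  ultimately show ?thesis
    by (simp add: Sp_def J_mat_square uminus_matrix_mult transpose_transpose)
qed

section \<open>Real symplectic matrices that expand the pairing\<close>

text \<open>The minus sign comes from \<open>i\<^sup>2 = -1\<close>: the block \<open>iB\<close> sends an imaginary part \<open>i y\<close> to the real
  part \<open>-B y\<close>.\<close>

definition expands_pairing :: "real^'d^'d \<Rightarrow> real^'d^'d \<Rightarrow> real^'d^'d \<Rightarrow> real^'d::finite^'d \<Rightarrow> bool" where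
  "expands_pairing A B C D \<longleftrightarrow> (\<forall>x y. x \<bullet> y \<le> (A *v x - B *v y) \<bullet> (C *v x + D *v y))"

text \<open>The symmetry of \<open>A\<^sup>T C\<close> merges the two mixed terms in \<open>x\<close> and \<open>e\<close>, and the relation
  \<open>A\<^sup>T D + C\<^sup>T B = I\<close> turns every term with \<open>D\<close> into one with \<open>C\<close> and a pairing.\<close>

lemma pairing_gain_complete_square:
  fixes A B C D :: "real^'d::finite^'d"
  assumes Sp: "block_mat A (- B) C D \<in> Sp" and e: "A *v e = B *v y"
  shows "(A *v x - B *v y) \<bullet> (C *v x + D *v y) - x \<bullet> y
    = (A *v (x - e)) \<bullet> (C *v (x - e)) - e \<bullet> y"
proof -
  have "transpose A ** C = transpose C ** A"
    using Sp by (simp add: Sp_block_mat_iff)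
  then have "x \<bullet> (transpose A ** C *v e) = x \<bullet> (transpose C ** A *v e)"
    by simp
  then have "(A *v x) \<bullet> (C *v e) = (C *v x) \<bullet> (A *v e)"
    by (simp add: inner_vector_matrix flip: matrix_vector_mul_assoc)
  moreover note Sp_blocks_inner[OF Sp, of x y] Sp_blocks_inner[OF Sp, of e y]
  ultimately show ?thesis
    using e by (simp add: matrix_vector_mult_diff_distrib inner_simps inner_commute)
qed

text \<open>On \<open>(x, t x)\<close> with \<open>x\<close> in the kernel of \<open>A\<close>, expansion reads \<open>2 t l + t\<^sup>2 m \<le> 0\<close>, where the
  symplectic relation identifies \<open>l\<close> with \<open>x \<bullet> x\<close>. A small positive \<open>t\<close> excludes \<open>l > 0\<close>.\<close>

lemma expands_pairing_imp_invertible: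
  fixes A B C D :: "real^'d::finite^'d"
  assumes Sp: "block_mat A (- B) C D \<in> Sp" and gr: "expands_pairing A B C D"
  shows "invertible A"
proof -
  have "x = 0" if Ax: "A *v x = 0" for x
  proof -
    define l where "l = (B *v x) \<bullet> (C *v x)"
    define m where "m = (B *v x) \<bullet> (D *v x)"
    have l: "l = x \<bullet> x"
      using Sp_blocks_inner[OF Sp, of x x] Ax by (simp add: l_def)
    have quad: "2 * t * l + t\<^sup>2 * m \<le> 0" for t
    proof -
      have "x \<bullet> (t *\<^sub>R x) \<le> (A *v x - B *v (t *\<^sub>R x)) \<bullet> (C *v x + D *v (t *\<^sub>R x))"
        using gr unfolding expands_pairing_def by blast
      then show ?thesis
        by (simp add: Ax l l_def[symmetric] m_def[symmetric] inner_simps power2_eq_square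
            matrix_vector_mult_scaleR algebra_simps)
    qed
    have "l \<le> 0"
    proof (rule ccontr)
      assume "\<not> l \<le> 0"
      \<comment> \<open>This \<open>t\<close> is small enough for the linear term to dominate: \<open>t \<bar>m\<bar> < l\<close>.\<close>
      then have pos: "l / (\<bar>m\<bar> + 1) > 0" by simp
      define t where "t = l / (\<bar>m\<bar> + 1)"
      have t: "t > 0" "t * (\<bar>m\<bar> + 1) = l"
        using pos by (simp_all add: t_def)
      have "t * (2 * l + t * m) \<le> 0"
        using quad[of t] by (simp add: power2_eq_square algebra_simps)
      then have "2 * l + t * m \<le> 0"
        using t(1) by (simp add: mult_le_0_iff)
      moreover have "- (t * m) \<le> t * \<bar>m\<bar>"
        using t(1) by (metis abs_ge_minus_self minus_mult_right mult_left_mono less_imp_le)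
      moreover have "t * \<bar>m\<bar> + t = l"
        using t(2) by (simp add: distrib_left)
      ultimately show False
        using t(1) \<open>\<not> l \<le> 0\<close> by linarith
    qed
    with l show "x = 0"
      by (metis inner_eq_zero_iff inner_ge_zero antisym)
  qed
  then show ?thesis
    by (metis invertible_left_inverse matrix_left_invertible_ker)
qed

text \<open>Both semidefiniteness conditions are rewritten as the two terms of the completed square; the
  symmetry they also require is automatic for symplectic matrices. Taking \<open>y = 0\<close>, and then
  \<open>x = e\<close>, isolates each term.\<close>

lemma expands_pairing_iff:
  fixes A B C D :: "real^'d::finite^'d"
  assumes Sp: "block_mat A (- B) C D \<in> Sp"
  shows "expands_pairing A B C D \<longleftrightarrow>
    invertible A \<and> pos_semidef (transpose A ** C) \<and> neg_semidef (A ** transpose B)"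
proof (cases "invertible A")
  case False
  then show ?thesis
    using expands_pairing_imp_invertible[OF Sp] by blast
next
  case True
  obtain A' where "A ** A' = mat 1" "A' ** A = mat 1"
    using True unfolding invertible_def by blast
  then have "A *v (A' *v v) = v" "transpose A *v (transpose A' *v v) = v" for v
    by (metis matrix_vector_mul_assoc matrix_transpose_mul transpose_mat matrix_vector_mul_lid)+
  then have surj: "\<exists>u. A *v u = v" "\<exists>w. transpose A *v w = v" for v
    by blast+
  have AC: "transpose (transpose A ** C) = transpose A ** C"
    using Sp by (simp add: Sp_block_mat_iff matrix_transpose_mul)
  have "block_mat (transpose A) (transpose C) (- transpose B) (transpose D) \<in> Sp"
    using transpose_in_Sp[OF Sp] by (simp add: transpose_block_mat uminus_matrix_mult)
  then have AB: "transpose (A ** transpose B) = A ** transpose B"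
    by (simp add: Sp_block_mat_iff matrix_transpose_mul uminus_matrix_mult)
  have pos: "pos_semidef (transpose A ** C) \<longleftrightarrow> (\<forall>v. 0 \<le> (A *v v) \<bullet> (C *v v))"
    by (simp add: pos_semidef_def AC inner_vector_matrix flip: matrix_vector_mul_assoc)
  have AB_form: "w \<bullet> (A ** transpose B *v w) = e \<bullet> (transpose A *v w)"
    if "A *v e = B *v (transpose A *v w)" for w e
  proof -
    have "w \<bullet> (A ** transpose B *v w) = w \<bullet> (B ** transpose A *v w)"
      using AB by (simp add: matrix_transpose_mul)
    also have "\<dots> = w \<bullet> (A *v e)"
      using that by (simp flip: matrix_vector_mul_assoc)
    finally show ?thesis
      by (simp add: inner_vector_matrix inner_commute)
  qed
  have neg: "neg_semidef (A ** transpose B) \<longleftrightarrow> (\<forall>e y. A *v e = B *v y \<longrightarrow> e \<bullet> y \<le> 0)"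
  proof
    assume neg: "neg_semidef (A ** transpose B)"
    show "\<forall>e y. A *v e = B *v y \<longrightarrow> e \<bullet> y \<le> 0"
    proof (intro allI impI)
      fix e y
      assume e: "A *v e = B *v y"
      obtain w where "transpose A *v w = y"
        using surj by blast
      with AB_form[of e w] e neg show "e \<bullet> y \<le> 0"
        unfolding neg_semidef_def by metis
    qed
  next
    assume *: "\<forall>e y. A *v e = B *v y \<longrightarrow> e \<bullet> y \<le> 0"
    have "w \<bullet> (A ** transpose B *v w) \<le> 0" for w
    proof -
      obtain e where "A *v e = B *v (transpose A *v w)"
        using surj by blast
      with AB_form[of e w] * show ?thesis
        by metis
    qed
    with AB show "neg_semidef (A ** transpose B)"
      by (simp add: neg_semidef_def)
  qed
  show ?thesis
  proof
    assume gr: "expands_pairing A B C D"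
    have "0 \<le> (A *v v) \<bullet> (C *v v)" for v
      using gr[unfolded expands_pairing_def, rule_format, of v 0] by simp
    moreover have "e \<bullet> y \<le> 0" if "A *v e = B *v y" for e y
      using gr[unfolded expands_pairing_def, rule_format, of e y] that by simp
    ultimately show "invertible A \<and> pos_semidef (transpose A ** C) \<and> neg_semidef (A ** transpose B)"
      using True pos neg by blast
  next
    assume *: "invertible A \<and> pos_semidef (transpose A ** C) \<and> neg_semidef (A ** transpose B)"
    show "expands_pairing A B C D"
      unfolding expands_pairing_def
    proof (intro allI)
      fix x y
      obtain e where e: "A *v e = B *v y"
        using surj by blast
      have "0 \<le> (A *v (x - e)) \<bullet> (C *v (x - e))" "e \<bullet> y \<le> 0"
        using * pos neg e by blast+
      with pairing_gain_complete_square[OF Sp e, of x]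
      show "x \<bullet> y \<le> (A *v x - B *v y) \<bullet> (C *v x + D *v y)"
        by linarith
    qed
  qed
qed

section \<open>Splitting a complex vector into two real phase-space points\<close>

definition phase_vec :: "real^'d \<Rightarrow> real^'d \<Rightarrow> real^'d \<Rightarrow> real^'d \<Rightarrow> complex^('d::finite + 'd)" where
  "phase_vec a b c d =
    (\<chi> i. case i of Inl k \<Rightarrow> Complex (a $ k) (b $ k) | Inr k \<Rightarrow> Complex (c $ k) (d $ k))"

lemma phase_vec_cases: "\<exists>a b c d. z = phase_vec a b c d"
proof -
  have "z = phase_vec (\<chi> k. Re (z $ Inl k)) (\<chi> k. Im (z $ Inl k))
      (\<chi> k. Re (z $ Inr k)) (\<chi> k. Im (z $ Inr k))"
    by (simp add: vec_eq_iff phase_vec_def split: sum.split)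
  then show ?thesis by blast
qed

text \<open>In the result, the pair of first and fourth components depends only on \<open>(a, d)\<close>, and the pair of
  second and third only on \<open>(b, c)\<close>: this is the decoupling.\<close>

lemma block_mat_phase_vec:
  "block_mat (cmat A) (imat B) (imat C) (cmat D) *v phase_vec a b c d =
   phase_vec (A *v a - B *v d) (A *v b + B *v c) (D *v c - C *v b) (C *v a + D *v d)"
  by (simp add: vec_eq_iff phase_vec_def block_mat_def matrix_vector_mult_def sum_UNIV_Plus
      complex_eq_iff sum_subtractf sum.distrib sum_negf split: sum.split)

lemma sigma_phase_vec:
  "inverse \<i> * sigma (phase_vec a b c d) (cnj_vec (phase_vec a b c d))
    = complex_of_real (2 * (a \<bullet> d - b \<bullet> c))"
  by (simp add: sigma_def scalar_product_def J_mat_def block_mat_def phase_vec_def cnj_vec_def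
      matrix_vector_mult_def sum_UNIV_Plus mat_def complex_eq_iff inner_vec_def
      if_distrib if_distribR sum_subtractf sum.distrib sum_negf mult.commute cong: if_cong)

text \<open>The gain of the Hermitian form at \<open>z\<close> is twice the sum of the gains of the pairing at \<open>(a, d)\<close> and
  at \<open>(b, -c)\<close>. These two points are independent and the gain vanishes at the origin, so the
  sum is always nonnegative iff each single gain is.\<close>

lemma Sp_plus_iff_expands_pairing:
  fixes A B C D :: "real^'d::finite^'d"
  assumes "block_mat (cmat A) (imat B) (imat C) (cmat D) \<in> Sp"
  shows "block_mat (cmat A) (imat B) (imat C) (cmat D) \<in> Sp_plus \<longleftrightarrow> expands_pairing A B C D"
proof -
  let ?S = "block_mat (cmat A) (imat B) (imat C) (cmat D)"
  define q where "q x y = (A *v x - B *v y) \<bullet> (C *v x + D *v y) - x \<bullet> y" for x y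
  have neg: "M *v (- v) = - (M *v v)" for M :: "real^'d^'d" and v
    by (metis matrix_vector_mult_diff_distrib diff_0 matrix_vector_mult_0_right)
  have gain: "inverse \<i> * (sigma (?S *v z) (cnj_vec (?S *v z)) - sigma z (cnj_vec z))
      = complex_of_real (2 * (q a d + q b (- c)))" if "z = phase_vec a b c d" for z a b c d
    unfolding right_diff_distrib that block_mat_phase_vec sigma_phase_vec
    by (simp add: q_def neg inner_simps algebra_simps)
  have "?S \<in> Sp_plus \<longleftrightarrow> (\<forall>a b c d. 0 \<le> q a d + q b (- c))"
  proof
    assume *: "?S \<in> Sp_plus"
    show "\<forall>a b c d. 0 \<le> q a d + q b (- c)"
    proof (intro allI)
      fix a b c d
      have "complex_of_real (2 * (q a d + q b (- c))) \<in> \<real>\<^sub>\<ge>\<^sub>0"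
        using * gain[OF refl, of a b c d] unfolding Sp_plus_def mem_Collect_eq by metis
      then show "0 \<le> q a d + q b (- c)"
        unfolding nonneg_Reals_of_real_iff by simp
    qed
  next
    assume *: "\<forall>a b c d. 0 \<le> q a d + q b (- c)"
    have "inverse \<i> * (sigma (?S *v z) (cnj_vec (?S *v z)) - sigma z (cnj_vec z)) \<in> \<real>\<^sub>\<ge>\<^sub>0" for z
    proof -
      obtain a b c d where z: "z = phase_vec a b c d"
        using phase_vec_cases by blast
      show ?thesis
        unfolding gain[OF z] nonneg_Reals_of_real_iff using *[rule_format, of a d b c]
        by (intro mult_nonneg_nonneg) simp_all
    qed
    with assms show "?S \<in> Sp_plus"
      unfolding Sp_plus_def by blast
  qed
  also have "\<dots> \<longleftrightarrow> (\<forall>x y. 0 \<le> q x y)"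
  proof
    assume *: "\<forall>a b c d. 0 \<le> q a d + q b (- c)"
    have "q 0 (- 0) = 0"
      by (simp add: q_def)
    then show "\<forall>x y. 0 \<le> q x y"
      using * by (metis add.right_neutral)
  qed (simp add: add_nonneg_nonneg)
  finally show ?thesis
    by (simp add: expands_pairing_def q_def)
qed

section \<open>Characterisation of the tilde-invariant elements of the semigroup\<close>

text \<open>A block decomposition is unique, so the existential quantifiers in both characterisations can
  only be witnessed by the blocks that the real quadruple \<open>A, B, C, D\<close> below provides; each characterisation then reduces to
  \<open>expands_pairing_iff\<close>.\<close>

theorem theorem5p10:
  fixes S :: "complex^('d::finite + 'd)^('d + 'd)"
  assumes "S \<in> Sp" and "tilde_mat S = S"
  shows
    "(S \<in> Sp_plus \<longleftrightarrow>
       (\<exists>A B C D :: real^'d^'d.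
          S = block_mat
                (map_matrix complex_of_real A) (map_matrix (\<lambda>b. \<i> * complex_of_real b) B)
                (map_matrix (\<lambda>c. \<i> * complex_of_real c) C) (map_matrix complex_of_real D) \<and>
          block_mat A (- B) C D \<in> Sp \<and>
          invertible A \<and>
          pos_semidef (transpose A ** C) \<and>
          neg_semidef (A ** transpose B)))
     \<and>
     (S \<in> Sp_plus \<longleftrightarrow>
       (\<exists>A B C D :: complex^'d^'d.
          S = block_mat A B C D \<and>
          map_matrix Re C = 0 \<and> map_matrix Re B = 0 \<and>
          A \<in> map_matrix complex_of_real ` {A' :: real^'d^'d. invertible A'} \<and>
          pos_semidef (map_matrix Im (transpose A ** C)) \<and>
          neg_semidef (map_matrix Im (A ** transpose B))))"
proof -
  obtain A B C D :: "real^'d^'d"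
    where S: "S = block_mat (cmat A) (imat B) (imat C) (cmat D)"
      and Sp: "block_mat A (- B) C D \<in> Sp"
    using tilde_fixed_decomposition[OF assms] by blast
  have inj: "cmat X = cmat Y \<longleftrightarrow> X = Y" "imat X = imat Y \<longleftrightarrow> X = Y" for X Y :: "real^'d^'d"
    by (simp_all add: vec_eq_iff)
  have Re_imat: "map_matrix Re (imat X) = 0" for X :: "real^'d^'d"
    by (simp add: vec_eq_iff)
  have Im_mult: "map_matrix Im (transpose (cmat A) ** imat C) = transpose A ** C"
    "map_matrix Im (cmat A ** transpose (imat B)) = A ** transpose B"
    by (simp_all add: vec_eq_iff matrix_matrix_mult_def transpose_def)
  have inv: "cmat A \<in> cmat ` {A'. invertible A'} \<longleftrightarrow> invertible A"
    by (simp add: image_iff inj)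
  have "S \<in> Sp_plus \<longleftrightarrow>
    invertible A \<and> pos_semidef (transpose A ** C) \<and> neg_semidef (A ** transpose B)"
    using Sp_plus_iff_expands_pairing[of A B C D] expands_pairing_iff[OF Sp] assms(1) unfolding S by simp
  moreover have "(\<exists>A' B' C' D' :: real^'d^'d.
      S = block_mat (cmat A') (imat B') (imat C') (cmat D') \<and> block_mat A' (- B') C' D' \<in> Sp \<and>
      invertible A' \<and> pos_semidef (transpose A' ** C') \<and> neg_semidef (A' ** transpose B'))
    \<longleftrightarrow> invertible A \<and> pos_semidef (transpose A ** C) \<and> neg_semidef (A ** transpose B)"
    unfolding S block_mat_eq_iff inj using Sp by simp
  moreover have "(\<exists>A' B' C' D' :: complex^'d^'d.
      S = block_mat A' B' C' D' \<and> map_matrix Re C' = 0 \<and> map_matrix Re B' = 0 \<and>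
      A' \<in> cmat ` {A'. invertible A'} \<and>
      pos_semidef (map_matrix Im (transpose A' ** C')) \<and>
      neg_semidef (map_matrix Im (A' ** transpose B')))
    \<longleftrightarrow> invertible A \<and> pos_semidef (transpose A ** C) \<and> neg_semidef (A ** transpose B)"
    (is "?blocks \<longleftrightarrow> ?real")
  proof
    assume ?blocks
    then have "cmat A \<in> cmat ` {A'. invertible A'}"
      "pos_semidef (map_matrix Im (transpose (cmat A) ** imat C))"
      "neg_semidef (map_matrix Im (cmat A ** transpose (imat B)))"
      unfolding S block_mat_eq_iff by auto
    then show ?real
      unfolding inv Im_mult by blast
  next
    assume ?real
    then show ?blocks
      by (intro exI[of _ "cmat A"] exI[of _ "imat B"] exI[of _ "imat C"] exI[of _ "cmat D"] conjI)
        (simp_all only: S Re_imat inv Im_mult)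
  qed
  ultimately show ?thesis
    by (simp only:)
qed

end
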